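(* Let $(\Omega,\mathcal A,\mu)$ be a measure space, $(X,\rho)$ a separable metric space, $x_0\in X$ a fixed point of $X$, $\mathbb K\in\{\mathbb R,\mathbb C\}$, and $\lambda\in[0,1)$. Let $f\colon X\times\Omega\to X$ and $g\colon\Omega\to\mathbb K$ satisfy: (H$_1$) for every $x\in X$ and every Borel set $B\subset X$, $\{\omega\in\Omega: f(x,\omega)\in B\}\in\mathcal A$; (H$_2$) $g$ is integrable, $\int_\Omega|g(\omega)|\rho(f(x,\omega),x)\,\mu(d\omega)<\infty$ for every $x\in X$, and $\int_\Omega|g(\omega)|\rho(f(x,\omega),f(z,\omega))\,\mu(d\omega)\le\lambda\rho(x,z)$ for all $x,z\in X$. Assume that $\gamma=\int_\Omega g(\omega)\,\mu(d\omega)$ is different from $1$, and let $Y$ be a separable Banach space over $\mathbb K$. Then: (i) For any $F\in Lip(X,Y)$ the function $\varphi^F\colon X\to Y$ defined by $$\varphi^F(x)=\frac{1}{1-\gamma}\left(\sum_{n=1}^{\infty}\big(F_n(x)-\gamma F_{n-1}(x)\big)+F(x)\right)\quad\text{for }x\in X,$$ where $F_0(x)=F(x)$ and $F_n(x)=\int_\Omega g(\omega)F_{n-1}(f(x,\omega))\,\mu(d\omega)$ for $x\in X$ and $n\in\mathbb N$, is the only Lipschitzian solution $\varphi\colon X\to Y$ of the equation $$\varphi(x)=\int_\Omega g(\omega)\varphi\big(f(x,\omega)\big)\,\mu(d\omega)+F(x)\qquad(x\in X);$$ the operator $F\mapsto\varphi^F$, $F\in Lip(X,Y)$, is a linear homeomorphism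 of $(Lip(X,Y),\|\cdot\|_{Lip})$ onto itself, and $$\|\varphi^F\|_{Lip}\le\frac{c}{|1-\gamma|}\|F\|_{Lip}\quad\text{for every }F\in Lip(X,Y),$$ where $$c_0=\frac{1}{1-\lambda}\left(\int_\Omega|g(\omega)|\rho\big(f(x_0,\omega),x_0\big)\,\mu(d\omega)+1+|\gamma|\right),\qquad c=\max\{1,c_0\}.$$ (ii) If additionally $$d_0=\sup\left\{\int_\Omega|g(\omega)|\rho\big(f(x,\omega),x\big)\,\mu(d\omega):x\in X\right\}$$ is finite, then the restriction of the operator $F\mapsto\varphi^F$ to $BL(X,Y)$ is a linear homeomorphism of $(BL(X,Y),\|\cdot\|_{BL})$ onto itself, and $$\|\varphi^F\|_{BL}\le\frac{d}{|1-\gamma|}\|F\|_{BL}\quad\text{for every }F\in BL(X,Y),$$ where $$d=\max\left\{1,\frac{d_0+1+|\gamma|}{1-\lambda}\right\}.$$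
   Context: $Lip(X,Y)$ is the linear space of all Lipschitzian functions $u\colon X\to Y$ (i.e. satisfying a Lipschitz condition with some finite constant), and $\|u\|_L$ denotes the smallest Lipschitz constant of $u$. With the fixed point $x_0\in X$, the norm on $Lip(X,Y)$ is $\|u\|_{Lip}=\|u(x_0)\|+\|u\|_L$. $BL(X,Y)$ is the linear subspace of all Lipschitzian and bounded functions $u\colon X\to Y$, with the norm $\|u\|_{BL}=\sup\{\|u(x)\|:x\in X\}+\|u\|_L$. Integrals of vector-valued functions are Bochner integrals. Under (H$_1$) and (H$_2$), for $F\in Lip(X,Y)$ the functions $F_n$ are well defined: for each $n$ the function $F_{n-1}$ is Lipschitzian and $\omega\mapsto g(\omega)F_{n-1}(f(x,\omega))$ is Bochner integrable for every $x\in X$. A solution of the equation is a function $\varphi\colon X\to Y$ such that for every $x\in X$ the function $\omega\mapsto g(\omega)\varphi(f(x,\omega))$ is Bochner integrable and the equality holds. *)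

theory Defs
  imports "HOL-Analysis.Analysis"
begin

text \<open>
  The scalar field is \<open>\<real>\<close> or \<open>\<complex>\<close>. The superclasses \<open>banach\<close> and \<open>second_countable_topology\<close> hold
  for both fields; they are listed because the Bochner integral needs the sort.
\<close>

class real_or_complex = real_normed_field + banach + second_countable_topology +
  assumes isometric_real_or_complex:
    "(\<exists>h :: 'a \<Rightarrow> real. bij h \<and> (\<forall>a b. h (a + b) = h a + h b) \<and> (\<forall>a b. h (a * b) = h a * h b) \<and>
        (\<forall>r a. h (r *\<^sub>R a) = r *\<^sub>R h a) \<and> (\<forall>a. norm (h a) = norm a)) \<or>
     (\<exists>h :: 'a \<Rightarrow> complex. bij h \<and> (\<forall>a b. h (a + b) = h a + h b) \<and> (\<forall>a b. h (a * b) = h a * h b) \<and>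
        (\<forall>r a. h (r *\<^sub>R a) = r *\<^sub>R h a) \<and> (\<forall>a. norm (h a) = norm a))"

instance real :: real_or_complex
  by standard (rule disjI1, rule exI[of _ id], simp)

instance complex :: real_or_complex
  by standard (rule disjI2, rule exI[of _ id], simp)

text \<open>
  The type classes on \<open>'y\<close> give a separable real Banach space; the locale extends its real scalar
  multiplication to a \<open>'k\<close>-scalar multiplication for which the norm is homogeneous.
\<close>

locale separable_banach_over = vector_space sc
  for sc :: "'k::real_or_complex \<Rightarrow> 'y::{banach, second_countable_topology} \<Rightarrow> 'y" +
  assumes norm_scale: "norm (sc a y) = norm a * norm y"
    and scale_of_real: "sc (of_real r) y = r *\<^sub>R y"

definition Lip :: "('x::metric_space \<Rightarrow> 'y::real_normed_vector) set" where
  "Lip = {u. \<exists>C. C-lipschitz_on UNIV u}"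

definition lip_const :: "('x::metric_space \<Rightarrow> 'y::real_normed_vector) \<Rightarrow> real" where
  "lip_const u = (LEAST C. C-lipschitz_on UNIV u)"

definition lip_norm :: "'x::metric_space \<Rightarrow> ('x \<Rightarrow> 'y::real_normed_vector) \<Rightarrow> real" where
  "lip_norm x0 u = norm (u x0) + lip_const u"

definition BL :: "('x::metric_space \<Rightarrow> 'y::real_normed_vector) set" where
  "BL = {u \<in> Lip. bounded (range u)}"

definition bl_norm :: "('x::metric_space \<Rightarrow> 'y::real_normed_vector) \<Rightarrow> real" where
  "bl_norm u = (SUP x. norm (u x)) + lip_const u"

text \<open>
  Topology induced by the metric \<open>N (u - v)\<close> on \<open>S\<close>. The locale \<open>Metric_space\<close> requires the distance to be
  nonnegative and symmetric also off the carrier, hence the value 0 there.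
\<close>

definition norm_topology ::
    "('x \<Rightarrow> 'y::real_normed_vector) set \<Rightarrow> (('x \<Rightarrow> 'y) \<Rightarrow> real) \<Rightarrow> ('x \<Rightarrow> 'y) topology" where
  "norm_topology S N =
     Metric_space.mtopology S (\<lambda>u v. if u \<in> S \<and> v \<in> S then N (\<lambda>x. u x - v x) else 0)"

text \<open>
  Linear homeomorphism of a function space \<open>S\<close> with norm \<open>N\<close> onto itself.
  The vector space operations on \<open>S\<close> are pointwise.
\<close>

definition linear_homeomorphism ::
    "('k \<Rightarrow> 'y \<Rightarrow> 'y) \<Rightarrow> ('x \<Rightarrow> 'y::real_normed_vector) set \<Rightarrow> (('x \<Rightarrow> 'y) \<Rightarrow> real) \<Rightarrow>
     (('x \<Rightarrow> 'y) \<Rightarrow> 'x \<Rightarrow> 'y) \<Rightarrow> bool" where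
  "linear_homeomorphism sc S N T \<longleftrightarrow>
     (\<forall>u\<in>S. \<forall>v\<in>S. T (\<lambda>x. u x + v x) = (\<lambda>x. T u x + T v x)) \<and>
     (\<forall>a. \<forall>u\<in>S. T (\<lambda>x. sc a (u x)) = (\<lambda>x. sc a (T u x))) \<and>
     homeomorphic_map (norm_topology S N) (norm_topology S N) T"

primrec iterate ::
    "'w measure \<Rightarrow> ('k \<Rightarrow> 'y \<Rightarrow> 'y::{banach, second_countable_topology}) \<Rightarrow> ('x \<Rightarrow> 'w \<Rightarrow> 'x) \<Rightarrow>
     ('w \<Rightarrow> 'k) \<Rightarrow> ('x \<Rightarrow> 'y) \<Rightarrow> nat \<Rightarrow> 'x \<Rightarrow> 'y" where
  "iterate M sc f g F 0 = F"
| "iterate M sc f g F (Suc n) =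
     (\<lambda>x. \<integral>\<omega>. sc (g \<omega>) (iterate M sc f g F n (f x \<omega>)) \<partial>M)"

definition is_solution ::
    "'w measure \<Rightarrow> ('k \<Rightarrow> 'y \<Rightarrow> 'y::{banach, second_countable_topology}) \<Rightarrow> ('x \<Rightarrow> 'w \<Rightarrow> 'x) \<Rightarrow>
     ('w \<Rightarrow> 'k) \<Rightarrow> ('x \<Rightarrow> 'y) \<Rightarrow> ('x \<Rightarrow> 'y) \<Rightarrow> bool" where
  "is_solution M sc f g F \<phi> \<longleftrightarrow>
     (\<forall>x. integrable M (\<lambda>\<omega>. sc (g \<omega>) (\<phi> (f x \<omega>))) \<and>
          \<phi> x = (\<integral>\<omega>. sc (g \<omega>) (\<phi> (f x \<omega>)) \<partial>M) + F x)"

text \<open>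
  The summation index is shifted by one, so the \<open>n\<close>-th summand is the one for \<open>n + 1\<close>;
  the value is meaningful only if the series converges.
\<close>

definition sol ::
    "'w measure \<Rightarrow> ('k::real_or_complex \<Rightarrow> 'y \<Rightarrow> 'y::{banach, second_countable_topology}) \<Rightarrow>
     ('x \<Rightarrow> 'w \<Rightarrow> 'x) \<Rightarrow> ('w \<Rightarrow> 'k) \<Rightarrow> ('x \<Rightarrow> 'y) \<Rightarrow> 'x \<Rightarrow> 'y" where
  "sol M sc f g F x =
     (let \<gamma> = (\<integral>\<omega>. g \<omega> \<partial>M) in
       sc (1 / (1 - \<gamma>))
         ((\<Sum>n. iterate M sc f g F (Suc n) x - sc \<gamma> (iterate M sc f g F n x)) + F x))"

text \<open>The least Lipschitz constant exists, and the two norms induce metrics.\<close>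

lemma lip_const_props:
  fixes u :: "'x::metric_space \<Rightarrow> 'y::real_normed_vector"
  assumes "u \<in> Lip"
  shows lip_const_lipschitz: "(lip_const u)-lipschitz_on UNIV u"
    and lip_const_le: "C-lipschitz_on UNIV u \<Longrightarrow> lip_const u \<le> C"
proof -
  let ?A = "{C. C-lipschitz_on UNIV u}"
  have ne: "?A \<noteq> {}" using assms by (auto simp: Lip_def)
  have bdd: "bdd_below ?A" by (rule bdd_belowI[of _ 0]) (auto simp: lipschitz_on_def)
  have I: "(Inf ?A)-lipschitz_on UNIV u"
  proof (rule lipschitz_onI)
    show "0 \<le> Inf ?A" using ne by (intro cInf_greatest) (auto simp: lipschitz_on_def)
    fix x y
    show "dist (u x) (u y) \<le> Inf ?A * dist x y"
    proof (cases "x = y")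
      case False
      then have "dist (u x) (u y) / dist x y \<le> Inf ?A"
        using ne by (intro cInf_greatest) (auto simp: lipschitz_on_def divide_le_eq)
      then show ?thesis using False by (simp add: divide_le_eq)
    qed simp
  qed
  have eq: "lip_const u = Inf ?A"
    unfolding lip_const_def using I bdd
    by (intro Least_equality) (auto intro: cInf_lower)
  show "(lip_const u)-lipschitz_on UNIV u" using I eq by simp
  show "lip_const u \<le> C" if "C-lipschitz_on UNIV u"
    using that bdd eq by (auto intro: cInf_lower)
qed

lemma lip_const_nonneg: "u \<in> Lip \<Longrightarrow> 0 \<le> lip_const u"
  using lip_const_lipschitz lipschitz_on_nonneg by blast

lemma Lip_diff:
  assumes "u \<in> Lip" "v \<in> Lip"
  shows "(\<lambda>x. u x - v x) \<in> Lip" "lip_const (\<lambda>x. u x - v x) \<le> lip_const u + lip_const v"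
proof -
  have *: "(lip_const u + lip_const v)-lipschitz_on UNIV (\<lambda>x. u x - v x)"
    using assms by (intro lipschitz_on_diff lip_const_lipschitz)
  then show "(\<lambda>x. u x - v x) \<in> Lip" by (auto simp: Lip_def)
  with * show "lip_const (\<lambda>x. u x - v x) \<le> lip_const u + lip_const v"
    by (rule lip_const_le[rotated])
qed

lemma lip_const_diff_commute: "lip_const (\<lambda>x. u x - v x) = lip_const (\<lambda>x. v x - u x)"
proof -
  have "dist (u x - v x) (u y - v y) = dist (v x - u x) (v y - u y)" for x y
  proof -
    have "v x - u x - (v y - u y) = - (u x - v x - (u y - v y))" by simp
    then show ?thesis by (simp only: dist_norm norm_minus_cancel)
  qed
  then show ?thesis by (simp add: lip_const_def lipschitz_on_def)
qed

lemma lip_const_triangle: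
  assumes "u \<in> Lip" "v \<in> Lip" "w \<in> Lip"
  shows "lip_const (\<lambda>x. u x - w x) \<le> lip_const (\<lambda>x. u x - v x) + lip_const (\<lambda>x. v x - w x)"
proof -
  have "lip_const (\<lambda>x. (u x - v x) - (w x - v x))
      \<le> lip_const (\<lambda>x. u x - v x) + lip_const (\<lambda>x. w x - v x)"
    using assms by (intro Lip_diff)
  then show ?thesis by (simp add: lip_const_diff_commute[of w v])
qed

lemma lip_const_0: "lip_const (\<lambda>x::'x::metric_space. 0::'y::real_normed_vector) = 0"
proof -
  let ?z = "\<lambda>x::'x. 0::'y"
  have 0: "0-lipschitz_on UNIV ?z" by (simp add: lipschitz_on_def)
  then have "?z \<in> Lip" by (auto simp: Lip_def)
  with lip_const_le[OF this 0] lip_const_nonneg[OF this] show ?thesis by simp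
qed

lemma Lip_eqI:
  assumes "u \<in> Lip" "v \<in> Lip" "lip_const (\<lambda>x. u x - v x) = 0" "u x0 = v x0"
  shows "u = v"
proof
  fix x
  have "0-lipschitz_on UNIV (\<lambda>x. u x - v x)"
    using lip_const_lipschitz[OF Lip_diff(1)[OF assms(1,2)]] assms(3) by simp
  then have "dist (u x - v x) (u x0 - v x0) \<le> 0" unfolding lipschitz_on_def by force
  then show "u x = v x" using assms(4) by simp
qed

lemma Metric_space_Lip:
  "Metric_space Lip (\<lambda>u v. if u \<in> Lip \<and> v \<in> Lip then lip_norm x0 (\<lambda>x. u x - v x) else 0)"
proof
  fix u v w :: "'a \<Rightarrow> 'b"
  let ?d = "\<lambda>u v. if u \<in> Lip \<and> v \<in> Lip then lip_norm x0 (\<lambda>x. u x - v x :: 'b) else 0"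
  show "0 \<le> ?d u v"
    by (auto simp: lip_norm_def Lip_diff(1) lip_const_nonneg)
  show "?d u v = ?d v u"
    by (simp add: lip_norm_def lip_const_diff_commute[of u v] norm_minus_commute)
  show "?d u v = 0 \<longleftrightarrow> u = v" if uv: "u \<in> Lip" "v \<in> Lip"
  proof
    assume "?d u v = 0"
    then have "norm (u x0 - v x0) + lip_const (\<lambda>x. u x - v x) = 0"
      using uv by (simp add: lip_norm_def)
    moreover have "0 \<le> lip_const (\<lambda>x. u x - v x)"
      using uv by (intro lip_const_nonneg Lip_diff)
    ultimately have "norm (u x0 - v x0) = 0 \<and> lip_const (\<lambda>x. u x - v x) = 0"
      by (simp add: add_nonneg_eq_0_iff)
    then show "u = v" using Lip_eqI[OF uv, of x0] by simp
  qed (simp add: lip_norm_def lip_const_0)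
  show "?d u w \<le> ?d u v + ?d v w" if "u \<in> Lip" "v \<in> Lip" "w \<in> Lip"
    using that lip_const_triangle[OF that] norm_triangle_ineq[of "u x0 - v x0" "v x0 - w x0"]
    by (simp add: lip_norm_def)
qed

lemma norm_le_SUP:
  assumes "bounded (range u)"
  shows "norm (u x) \<le> (SUP x. norm (u x))"
proof (rule cSUP_upper)
  show "bdd_above (range (\<lambda>x. norm (u x)))"
    using assms by (auto simp: bounded_iff intro: bdd_aboveI)
qed simp

lemma BL_diff: "u \<in> BL \<Longrightarrow> v \<in> BL \<Longrightarrow> (\<lambda>x. u x - v x) \<in> BL"
  by (auto simp: BL_def Lip_diff bounded_minus_comp)

lemma Metric_space_BL:
  "Metric_space BL (\<lambda>u v. if u \<in> BL \<and> v \<in> BL then bl_norm (\<lambda>x. u x - v x) else 0)"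
proof
  fix u v w :: "'a \<Rightarrow> 'b"
  let ?d = "\<lambda>u v. if u \<in> BL \<and> v \<in> BL then bl_norm (\<lambda>x. u x - v x :: 'b) else 0"
  have L: "u \<in> Lip" if "u \<in> BL" for u :: "'a \<Rightarrow> 'b"
    using that by (simp add: BL_def)
  have le: "norm (u x) \<le> (SUP x. norm (u x))" if "u \<in> BL" for u :: "'a \<Rightarrow> 'b" and x
    using that by (intro norm_le_SUP) (simp add: BL_def)
  have nn: "0 \<le> (SUP x. norm (u x))" if "u \<in> BL" for u :: "'a \<Rightarrow> 'b"
    using le[OF that] norm_ge_zero order_trans by blast
  show "0 \<le> ?d u v"
    by (auto simp: bl_norm_def BL_diff nn L lip_const_nonneg)
  show "?d u v = ?d v u"
    by (simp add: bl_norm_def lip_const_diff_commute[of u v] norm_minus_commute)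
  show "?d u v = 0 \<longleftrightarrow> u = v" if uv: "u \<in> BL" "v \<in> BL"
  proof
    assume "?d u v = 0"
    then have "(SUP x. norm (u x - v x)) + lip_const (\<lambda>x. u x - v x) = 0"
      using uv by (simp add: bl_norm_def)
    then have "(SUP x. norm (u x - v x)) = 0"
      using nn[OF BL_diff[OF uv]] lip_const_nonneg[OF L[OF BL_diff[OF uv]]] by linarith
    then show "u = v" using le[OF BL_diff[OF uv]] by auto
  qed (simp add: bl_norm_def lip_const_0)
  show "?d u w \<le> ?d u v + ?d v w" if uvw: "u \<in> BL" "v \<in> BL" "w \<in> BL"
  proof -
    have "norm (u x - w x) \<le> (SUP x. norm (u x - v x)) + (SUP x. norm (v x - w x))" for x
      using norm_triangle_ineq[of "u x - v x" "v x - w x"]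
        le[OF BL_diff[OF uvw(1,2)], of x] le[OF BL_diff[OF uvw(2,3)], of x] by simp
    then have "(SUP x. norm (u x - w x)) \<le> (SUP x. norm (u x - v x)) + (SUP x. norm (v x - w x))"
      by (intro cSUP_least) auto
    then show ?thesis using uvw lip_const_triangle[of u v w] by (simp add: bl_norm_def L)
  qed
qed

end

theory Submission
  imports Defs
begin

text \<open>
  The operator \<open>P u x = \<integral>g(\<omega>) u(f(x,\<omega>))\<close> multiplies Lipschitz constants by at most \<open>\<lambda>\<close>, and
  \<open>\<parallel>P u x - \<gamma> u x\<parallel>\<close> is at most the Lipschitz constant of \<open>u\<close> times \<open>D x = \<integral>|g(\<omega>)| \<rho>(f(x,\<omega>), x)\<close>. Hence the
  corrector series \<open>H F = \<Sum>(F\<^sub>n\<^sub>+\<^sub>1 - \<gamma> F\<^sub>n)\<close> converges geometrically although \<open>\<Sum> F\<^sub>n\<close> need not, and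
  it satisfies \<open>P (H F) = H (P F) = H F - (P F - \<gamma> F)\<close>. So \<open>S = H F + F\<close> solves \<open>S = P S + (1 - \<gamma>) F\<close>.
  A Lipschitz fixed point of \<open>P\<close> is constant because \<open>\<lambda> < 1\<close>, and therefore zero because \<open>\<gamma> \<noteq> 1\<close>;
  this yields uniqueness, and with it the linearity of \<open>F \<mapsto> \<phi>\<^sup>F\<close>. The inverse operator is
  \<open>\<phi> \<mapsto> \<phi> - P \<phi>\<close>.
\<close>

section \<open>Linear homeomorphisms of normed function spaces\<close>

lemma Lip_I: "C-lipschitz_on UNIV u \<Longrightarrow> u \<in> Lip"
  by (auto simp: Lip_def)

lemma Lip_add: "u \<in> Lip \<Longrightarrow> v \<in> Lip \<Longrightarrow> (\<lambda>x. u x + v x) \<in> Lip"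
  using lipschitz_on_add[OF lip_const_lipschitz lip_const_lipschitz] by (auto simp: Lip_def)

text \<open>A bound on \<open>N (T u)\<close> together with compatibility with differences makes
  \<open>T\<close> Lipschitz for the metric \<open>N (u - v)\<close>, and Lipschitz maps are
  continuous.\<close>

lemma continuous_map_norm_topology:
  assumes S: "Metric_space S (\<lambda>u v. if u \<in> S \<and> v \<in> S then N (\<lambda>x. u x - v x) else 0)"
    and T: "\<And>u. u \<in> S \<Longrightarrow> T u \<in> S"
    and S_diff: "\<And>u v. u \<in> S \<Longrightarrow> v \<in> S \<Longrightarrow> (\<lambda>x. u x - v x) \<in> S"
    and T_diff: "\<And>u v. u \<in> S \<Longrightarrow> v \<in> S \<Longrightarrow> T (\<lambda>x. u x - v x) = (\<lambda>x. T u x - T v x)"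
    and bound: "\<And>u. u \<in> S \<Longrightarrow> N (T u) \<le> K * N u"
  shows "continuous_map (norm_topology S N) (norm_topology S N) T"
proof -
  let ?d = "\<lambda>u v. if u \<in> S \<and> v \<in> S then N (\<lambda>x. u x - v x) else 0"
  let ?m = "metric (S, ?d)"
  have m: "mspace ?m = S" "mdist ?m = ?d"
    using S by (simp_all add: Metric_space.mspace_metric Metric_space.mdist_metric)
  have "Lipschitz_continuous_map ?m ?m T"
    unfolding Lipschitz_continuous_map_def m
  proof (intro conjI exI ballI)
    show "T \<in> S \<rightarrow> S" using T by auto
    fix u v assume "u \<in> S" "v \<in> S"
    then show "?d (T u) (T v) \<le> K * ?d u v"
      using bound[OF S_diff, of u v] by (simp add: T T_diff)
  qed
  then show ?thesis
    using Lipschitz_continuous_imp_continuous_map[of ?m ?m T]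
    unfolding norm_topology_def mtopology_of_def m by simp
qed

text \<open>Two mutually inverse operators, each bounded in \<open>N\<close>, are both continuous by
  the previous lemma. The bound on \<open>R\<close> replaces any appeal to an open mapping
  theorem.\<close>

lemma linear_homeomorphismI:
  assumes S: "Metric_space S (\<lambda>u v. if u \<in> S \<and> v \<in> S then N (\<lambda>x. u x - v x) else 0)"
    and S_diff: "\<And>u v. u \<in> S \<Longrightarrow> v \<in> S \<Longrightarrow> (\<lambda>x. u x - v x) \<in> S"
    and T_add: "\<And>u v. u \<in> S \<Longrightarrow> v \<in> S \<Longrightarrow> T (\<lambda>x. u x + v x) = (\<lambda>x. T u x + T v x)"
    and T_scale: "\<And>a u. u \<in> S \<Longrightarrow> T (\<lambda>x. sc a (u x)) = (\<lambda>x. sc a (T u x))"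
    and T: "\<And>u. u \<in> S \<Longrightarrow> T u \<in> S"
    and T_bound: "\<And>u. u \<in> S \<Longrightarrow> N (T u) \<le> K * N u"
    and R: "\<And>u. u \<in> S \<Longrightarrow> R u \<in> S"
    and R_diff: "\<And>u v. u \<in> S \<Longrightarrow> v \<in> S \<Longrightarrow> R (\<lambda>x. u x - v x) = (\<lambda>x. R u x - R v x)"
    and R_bound: "\<And>u. u \<in> S \<Longrightarrow> N (R u) \<le> L * N u"
    and RT: "\<And>u. u \<in> S \<Longrightarrow> R (T u) = u"
    and TR: "\<And>u. u \<in> S \<Longrightarrow> T (R u) = u"
  shows "linear_homeomorphism sc S N T"
proof -
  \<comment> \<open>Additivity applied to (u - v) + v gives compatibility with differences
    directly.\<close>
  have T_diff: "T (\<lambda>x. u x - v x) = (\<lambda>x. T u x - T v x)" if "u \<in> S" "v \<in> S" for u v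
  proof -
    have "T (\<lambda>x. (u x - v x) + v x) = (\<lambda>x. T (\<lambda>x. u x - v x) x + T v x)"
      by (rule T_add) (use that S_diff in auto)
    then have "T u y = T (\<lambda>x. u x - v x) y + T v y" for y
      by simp
    then show ?thesis by (auto simp: fun_eq_iff)
  qed
  have top: "topspace (norm_topology S N) = S"
    unfolding norm_topology_def by (rule Metric_space.topspace_mtopology[OF S])
  have "homeomorphic_maps (norm_topology S N) (norm_topology S N) T R"
    unfolding homeomorphic_maps_def top
    by (intro conjI continuous_map_norm_topology[OF S T S_diff T_diff T_bound]
        continuous_map_norm_topology[OF S R S_diff R_diff R_bound]) (auto simp: RT TR)
  then show ?thesis
    unfolding linear_homeomorphism_def
    using T_add T_scale homeomorphic_maps_imp_map by blast
qed

section \<open>Scalar multiplication over the field\<close>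

context separable_banach_over
begin

text \<open>Makes \<open>sc\<close> continuous and lets it be exchanged with Bochner integrals in
  either argument. Real homogeneity comes from \<open>scale_of_real\<close>.\<close>

lemma bounded_bilinear_scale: "bounded_bilinear sc"
proof
  show "sc (a + b) y = sc a y + sc b y" for a b y
    by (rule scale_left_distrib)
  show "sc a (y + z) = sc a y + sc a z" for a y z
    by (rule scale_right_distrib)
  show "sc (r *\<^sub>R a) y = r *\<^sub>R sc a y" for r a y
    by (simp add: scaleR_conv_of_real scale_of_real[symmetric])
  show "sc a (r *\<^sub>R y) = r *\<^sub>R sc a y" for r a y
    by (simp add: scale_of_real[symmetric] mult.commute)
  show "\<exists>K. \<forall>a b. norm (sc a b) \<le> norm a * norm b * K"
    by (rule exI[of _ 1]) (simp add: norm_scale)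
qed

lemma borel_measurable_scale:
  assumes "a \<in> borel_measurable M" "v \<in> borel_measurable M"
  shows "(\<lambda>\<omega>. sc (a \<omega>) (v \<omega>)) \<in> borel_measurable M"
  using assms
  by (rule borel_measurable_continuous_Pair)
    (intro bounded_bilinear.continuous_on[OF bounded_bilinear_scale] continuous_intros)

lemma lipschitz_on_scale:
  assumes "C-lipschitz_on UNIV u"
  shows "(norm a * C)-lipschitz_on UNIV (\<lambda>x. sc a (u x))"
proof (rule lipschitz_onI)
  show "0 \<le> norm a * C" using assms by (simp add: lipschitz_on_def)
  fix x y
  have "dist (sc a (u x)) (sc a (u y)) = norm a * dist (u x) (u y)"
    by (simp add: dist_norm norm_scale flip: scale_right_diff_distrib)
  also have "\<dots> \<le> norm a * (C * dist x y)"
    using assms by (intro mult_left_mono) (auto simp: lipschitz_on_def)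
  finally show "dist (sc a (u x)) (sc a (u y)) \<le> norm a * C * dist x y"
    by (simp add: mult.assoc)
qed

lemma Lip_scale: "u \<in> Lip \<Longrightarrow> (\<lambda>x. sc a (u x)) \<in> Lip"
  using lipschitz_on_scale[OF lip_const_lipschitz] by (auto simp: Lip_def)

end

section \<open>The integral operator \<open>P\<close> on Lipschitz functions\<close>

locale contractive_kernel = separable_banach_over sc
  for sc :: "'k::real_or_complex \<Rightarrow> 'y::{banach, second_countable_topology} \<Rightarrow> 'y" +
  fixes M :: "'w measure"
    and f :: "'x::metric_space \<Rightarrow> 'w \<Rightarrow> 'x"
    and g :: "'w \<Rightarrow> 'k"
    and lam :: real
  assumes lam: "0 \<le> lam" "lam < 1"
    and measurable_kernel: "B \<in> sets borel \<Longrightarrow> {\<omega> \<in> space M. f x \<omega> \<in> B} \<in> sets M"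
    and integrable_g: "integrable M g"
    and finite_displacement: "(\<integral>\<^sup>+\<omega>. ennreal (norm (g \<omega>) * dist (f x \<omega>) x) \<partial>M) < \<infinity>"
    and contraction: "(\<integral>\<^sup>+\<omega>. ennreal (norm (g \<omega>) * dist (f x \<omega>) (f z \<omega>)) \<partial>M) \<le> ennreal (lam * dist x z)"
begin

definition \<gamma> :: 'k where
  "\<gamma> = (\<integral>\<omega>. g \<omega> \<partial>M)"

definition P :: "('x \<Rightarrow> 'y) \<Rightarrow> 'x \<Rightarrow> 'y" where
  "P u x = (\<integral>\<omega>. sc (g \<omega>) (u (f x \<omega>)) \<partial>M)"

definition D :: "'x \<Rightarrow> real" where
  "D x = (\<integral>\<omega>. norm (g \<omega>) * dist (f x \<omega>) x \<partial>M)"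

text \<open>The corrector series inside \<open>sol\<close>, without the summand \<open>F\<close> and
  the normalising factor.\<close>

definition H :: "('x \<Rightarrow> 'y) \<Rightarrow> 'x \<Rightarrow> 'y" where
  "H u x = (\<Sum>n. iterate M sc f g u (Suc n) x - sc \<gamma> (iterate M sc f g u n x))"

lemma f_measurable: "f x \<in> borel_measurable M"
  using measurable_kernel by (auto simp: measurable_def vimage_def Int_def conj_commute)

lemma g_measurable: "g \<in> borel_measurable M"
  using integrable_g by simp

lemma lipschitz_comp_measurable:
  assumes "C-lipschitz_on UNIV u"
  shows "(\<lambda>\<omega>. u (f x \<omega>)) \<in> borel_measurable M"
  by (rule measurable_compose[OF f_measurable])
    (intro borel_measurable_continuous_onI lipschitz_on_continuous_on[OF assms])

text \<open>Finiteness is assumed for the nonnegative integral; this turns it into Bochner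
  integrability, so \<open>D x\<close> is the true integral and not the default value 0.\<close>

lemma displacement_integrable: "integrable M (\<lambda>\<omega>. norm (g \<omega>) * dist (f x \<omega>) x)"
proof (rule integrableI_bounded)
  have "(\<lambda>\<omega>. dist (f x \<omega>) x) \<in> borel_measurable M"
    by (rule measurable_compose[OF f_measurable])
      (intro borel_measurable_continuous_onI continuous_intros)
  then show "(\<lambda>\<omega>. norm (g \<omega>) * dist (f x \<omega>) x) \<in> borel_measurable M"
    using g_measurable by simp
qed (use finite_displacement[of x] in simp)

lemma D_nonneg: "0 \<le> D x"
  unfolding D_def by (intro integral_nonneg_AE) simp

text \<open>A Lipschitz function may be unbounded, but its increment from \<open>u x\<close> is
  dominated by \<open>C\<close> times the displacement, which is integrable against |g|.\<close>

lemma increment_integrable: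
  assumes u: "C-lipschitz_on UNIV u"
  shows "integrable M (\<lambda>\<omega>. sc (g \<omega>) (u (f x \<omega>) - u x))" (is "integrable M ?h")
    and "norm (\<integral>\<omega>. sc (g \<omega>) (u (f x \<omega>) - u x) \<partial>M) \<le> C * D x"
proof -
  have bound: "norm (?h \<omega>) \<le> C * (norm (g \<omega>) * dist (f x \<omega>) x)" for \<omega>
  proof -
    have "norm (?h \<omega>) = norm (g \<omega>) * dist (u (f x \<omega>)) (u x)"
      by (simp add: norm_scale dist_norm)
    also have "\<dots> \<le> norm (g \<omega>) * (C * dist (f x \<omega>) x)"
      using u by (intro mult_left_mono) (auto simp: lipschitz_on_def)
    finally show ?thesis by (simp add: mult_ac)
  qed
  show int: "integrable M ?h"
  proof (rule Bochner_Integration.integrable_bound)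
    show "integrable M (\<lambda>\<omega>. C * (norm (g \<omega>) * dist (f x \<omega>) x))"
      using displacement_integrable by simp
    show "?h \<in> borel_measurable M"
      using lipschitz_comp_measurable[OF u, of x] g_measurable
      by (intro borel_measurable_scale) auto
    show "AE \<omega> in M. norm (?h \<omega>) \<le> norm (C * (norm (g \<omega>) * dist (f x \<omega>) x))"
      using bound by (intro AE_I2) (metis abs_ge_self order_trans real_norm_def)
  qed
  have "norm (\<integral>\<omega>. ?h \<omega> \<partial>M) \<le> (\<integral>\<omega>. C * (norm (g \<omega>) * dist (f x \<omega>) x) \<partial>M)"
    using displacement_integrable bound
    by (intro order_trans[OF integral_norm_bound] integral_mono integrable_norm int) auto
  then show "norm (\<integral>\<omega>. ?h \<omega> \<partial>M) \<le> C * D x"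
    by (simp add: D_def)
qed

lemma constant_integral:
  shows "integrable M (\<lambda>\<omega>. sc (g \<omega>) y)" and "(\<integral>\<omega>. sc (g \<omega>) y \<partial>M) = sc \<gamma> y"
  using integrable_bounded_linear[OF bounded_bilinear.bounded_linear_left[OF bounded_bilinear_scale] integrable_g]
    integral_bounded_linear[OF bounded_bilinear.bounded_linear_left[OF bounded_bilinear_scale] integrable_g]
  by (auto simp: \<gamma>_def)

text \<open>Splits the integrand into the increment from \<open>u x\<close>, integrable by
  domination, and the constant \<open>u x\<close>, integrable because \<open>g\<close> is.\<close>

lemma P_integrable:
  assumes "u \<in> Lip"
  shows "integrable M (\<lambda>\<omega>. sc (g \<omega>) (u (f x \<omega>)))"
  using Bochner_Integration.integrable_add[OF increment_integrable(1)[OF lip_const_lipschitz[OF assms]]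
      constant_integral(1)[of "u x"], of x]
  by (simp flip: scale_right_distrib)

text \<open>Since \<open>sc \<gamma> (u x)\<close> is the integral of the constant
  \<open>u x\<close> against \<open>g\<close>, the difference is the integral of an
  increment.\<close>

lemma P_diff_bound:
  assumes u: "C-lipschitz_on UNIV u"
  shows "norm (P u x - sc \<gamma> (u x)) \<le> C * D x"
  using increment_integrable(2)[OF u, of x] constant_integral P_integrable[OF Lip_I[OF u]]
  by (simp add: scale_right_diff_distrib P_def)

lemma P_bound:
  assumes u: "C-lipschitz_on UNIV u"
  shows "norm (P u x) \<le> norm \<gamma> * norm (u x) + C * D x"
  using P_diff_bound[OF u, of x] norm_triangle_ineq2[of "P u x" "sc \<gamma> (u x)"]
  by (simp add: norm_scale)

lemma P_lipschitz:
  assumes u: "C-lipschitz_on UNIV u"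
  shows "(lam * C)-lipschitz_on UNIV (P u)"
proof (rule lipschitz_onI)
  have C: "0 \<le> C" using u lipschitz_on_nonneg by blast
  then show "0 \<le> lam * C" using lam by simp
  fix x z
  let ?h = "\<lambda>\<omega>. sc (g \<omega>) (u (f x \<omega>) - u (f z \<omega>))"
  have int: "integrable M ?h"
    using P_integrable[OF Lip_I[OF u]] by (simp add: scale_right_diff_distrib)
  have "dist (P u x) (P u z) = norm (\<integral>\<omega>. ?h \<omega> \<partial>M)"
    using P_integrable[OF Lip_I[OF u]] by (simp add: scale_right_diff_distrib P_def dist_norm)
  also have "\<dots> \<le> (\<integral>\<omega>. norm (?h \<omega>) \<partial>M)"
    by (rule integral_norm_bound)
  also have "\<dots> \<le> lam * C * dist x z"
  \<comment> \<open>The contraction hypothesis bounds a nonnegative integral of distances, so the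
    integrand is divided by \<open>C\<close> before comparing; for C = 0 it vanishes.\<close>
  proof (cases "C = 0")
    case True
    then have "u (f x \<omega>) = u (f z \<omega>)" for \<omega>
      using u by (force simp: lipschitz_on_def)
    then show ?thesis using True by simp
  next
    case False
    with C have "C > 0" by simp
    have "ennreal (\<integral>\<omega>. norm (?h \<omega>) / C \<partial>M) = (\<integral>\<^sup>+\<omega>. ennreal (norm (?h \<omega>) / C) \<partial>M)"
      using int \<open>C > 0\<close> by (intro nn_integral_eq_integral[symmetric]) auto
    also have "\<dots> \<le> (\<integral>\<^sup>+\<omega>. ennreal (norm (g \<omega>) * dist (f x \<omega>) (f z \<omega>)) \<partial>M)"
    proof (intro nn_integral_mono ennreal_leI)
      fix \<omega>
      have "dist (u (f x \<omega>)) (u (f z \<omega>)) / C \<le> dist (f x \<omega>) (f z \<omega>)"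
        using u \<open>C > 0\<close> by (simp add: lipschitz_on_def divide_le_eq mult.commute)
      from mult_left_mono[OF this, of "norm (g \<omega>)"]
      show "norm (?h \<omega>) / C \<le> norm (g \<omega>) * dist (f x \<omega>) (f z \<omega>)"
        by (simp add: norm_scale dist_norm)
    qed
    also have "\<dots> \<le> ennreal (lam * dist x z)"
      by (rule contraction)
    finally have "(\<integral>\<omega>. norm (?h \<omega>) / C \<partial>M) \<le> lam * dist x z"
      using lam by (simp add: ennreal_le_iff)
    then show ?thesis
      using \<open>C > 0\<close> by (simp add: divide_le_eq mult_ac)
  qed
  finally show "dist (P u x) (P u z) \<le> lam * C * dist x z" .
qed

lemma P_Lip: "u \<in> Lip \<Longrightarrow> P u \<in> Lip"
  by (meson Lip_I lip_const_lipschitz P_lipschitz)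

lemma P_add: "u \<in> Lip \<Longrightarrow> v \<in> Lip \<Longrightarrow> P (\<lambda>x. u x + v x) = (\<lambda>x. P u x + P v x)"
  by (auto simp: P_def scale_right_distrib P_integrable)

lemma P_diff: "u \<in> Lip \<Longrightarrow> v \<in> Lip \<Longrightarrow> P (\<lambda>x. u x - v x) = (\<lambda>x. P u x - P v x)"
  by (auto simp: P_def scale_right_diff_distrib P_integrable)

lemma P_scale:
  assumes "u \<in> Lip"
  shows "P (\<lambda>x. sc a (u x)) = (\<lambda>x. sc a (P u x))"
proof
  fix x
  have "P (\<lambda>x. sc a (u x)) x = (\<integral>\<omega>. sc a (sc (g \<omega>) (u (f x \<omega>))) \<partial>M)"
    by (simp add: P_def mult.commute)
  also have "\<dots> = sc a (P u x)"
    unfolding P_def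
    by (rule integral_bounded_linear[OF bounded_bilinear.bounded_linear_right[OF bounded_bilinear_scale] P_integrable[OF assms]])
  finally show "P (\<lambda>x. sc a (u x)) x = sc a (P u x)" .
qed

section \<open>Iterates and the corrector series\<close>

lemma iterate_Suc_P: "iterate M sc f g u (Suc n) = P (iterate M sc f g u n)"
  by (simp add: P_def fun_eq_iff)

lemma iterate_P: "iterate M sc f g (P u) n = iterate M sc f g u (Suc n)"
  by (induction n) (auto simp: P_def fun_eq_iff)

lemma iterate_lipschitz:
  assumes "C-lipschitz_on UNIV u"
  shows "(lam ^ n * C)-lipschitz_on UNIV (iterate M sc f g u n)"
proof (induction n)
  case (Suc n)
  then show ?case
    unfolding iterate_Suc_P using P_lipschitz by (fastforce simp: mult.assoc)
qed (use assms in simp)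

lemma iterate_Lip: "u \<in> Lip \<Longrightarrow> iterate M sc f g u n \<in> Lip"
  by (meson Lip_I lip_const_lipschitz iterate_lipschitz)

text \<open>The iterates need not decay, but their Lipschitz constants do, like
  \<open>lam ^ n\<close>, and comparing \<open>P\<close> with multiplication by \<gamma> leaves a
  quantity controlled by the Lipschitz constant alone.\<close>

lemma H_term_bound:
  assumes "C-lipschitz_on UNIV u"
  shows "norm (iterate M sc f g u (Suc n) x - sc \<gamma> (iterate M sc f g u n x)) \<le> lam ^ n * (C * D x)"
  unfolding iterate_Suc_P
  using P_diff_bound[OF iterate_lipschitz[OF assms, of n], of x] by (simp add: mult.assoc)

lemma geometric_lam: "summable (\<lambda>n. lam ^ n * c)" "(\<Sum>n. lam ^ n * c) = c / (1 - lam)"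
proof -
  show "summable (\<lambda>n. lam ^ n * c)"
    using lam by (intro summable_mult2 summable_geometric) auto
  show "(\<Sum>n. lam ^ n * c) = c / (1 - lam)"
    using lam by (subst suminf_mult2[symmetric]) (auto simp: suminf_geometric intro: summable_geometric)
qed

lemma H_summable:
  assumes "u \<in> Lip"
  shows "summable (\<lambda>n. iterate M sc f g u (Suc n) x - sc \<gamma> (iterate M sc f g u n x))"
  using H_term_bound[OF lip_const_lipschitz[OF assms]]
  by (intro summable_comparison_test'[OF geometric_lam(1)]) auto

lemma H_bound:
  assumes "C-lipschitz_on UNIV u"
  shows "norm (H u x) \<le> C * D x / (1 - lam)"
  unfolding H_def geometric_lam(2)[symmetric]
  by (intro norm_suminf_le H_term_bound[OF assms] geometric_lam(1))

lemma H_lipschitz: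
  assumes u: "C-lipschitz_on UNIV u"
  shows "((lam + norm \<gamma>) * C / (1 - lam))-lipschitz_on UNIV (H u)"
proof (rule lipschitz_onI)
  have C: "0 \<le> C" using u lipschitz_on_nonneg by blast
  then show "0 \<le> (lam + norm \<gamma>) * C / (1 - lam)" using lam by simp
  fix x z
  define t where "t n x = iterate M sc f g u (Suc n) x - sc \<gamma> (iterate M sc f g u n x)" for n x
  have lip: "(lam ^ n * ((lam + norm \<gamma>) * C))-lipschitz_on UNIV (t n)" for n
  proof -
    \<comment> \<open>The later iterate carries one more factor \<open>lam\<close>, the scaled one a
      factor \<open>norm \<gamma>\<close>; this is the origin of
      \<open>lam + norm \<gamma>\<close>.\<close>
    have "(lam ^ Suc n * C + norm \<gamma> * (lam ^ n * C))-lipschitz_on UNIV (t n)"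
      unfolding t_def
      by (intro lipschitz_on_diff lipschitz_on_scale iterate_lipschitz u)
    then show ?thesis by (simp add: algebra_simps)
  qed
  have "norm (t n x - t n z) \<le> lam ^ n * ((lam + norm \<gamma>) * C * dist x z)" for n
    using lip[of n] by (simp add: lipschitz_on_def dist_norm mult.assoc)
  then have "norm (\<Sum>n. t n x - t n z) \<le> (\<Sum>n. lam ^ n * ((lam + norm \<gamma>) * C * dist x z))"
    by (intro norm_suminf_le geometric_lam(1))
  moreover have "H u x - H u z = (\<Sum>n. t n x - t n z)"
    unfolding H_def t_def using H_summable[OF Lip_I[OF u]] by (intro suminf_diff)
  ultimately show "dist (H u x) (H u z) \<le> (lam + norm \<gamma>) * C / (1 - lam) * dist x z"
    by (simp add: geometric_lam(2) dist_norm)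
qed

lemma H_Lip: "u \<in> Lip \<Longrightarrow> H u \<in> Lip"
  by (meson Lip_I lip_const_lipschitz H_lipschitz)

text \<open>Splitting off the summand of index 0 leaves the series started at \<open>P u\<close>,
  because starting from \<open>P u\<close> skips one iterate.\<close>

lemma H_unfold:
  assumes "u \<in> Lip"
  shows "H u = (\<lambda>x. P u x - sc \<gamma> (u x) + H (P u) x)"
proof
  fix x
  show "H u x = P u x - sc \<gamma> (u x) + H (P u) x"
    using suminf_split_head[OF H_summable[OF assms, of x]]
    by (simp add: H_def iterate_P P_def del: iterate.simps(2) flip: iterate_Suc_P)
      (simp add: P_def)
qed

text \<open>
  The commutator \<open>P (H u) - H (P u)\<close> does not change when \<open>u\<close> is replaced by \<open>P u\<close>, and it is bounded
  by a multiple of the Lipschitz constant of \<open>u\<close>; hence it vanishes.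
\<close>

lemma P_H:
  assumes "u \<in> Lip"
  shows "P (H u) = H (P u)"
proof
  fix x
  define E where "E u = P (H u) x - H (P u) x" for u
  \<comment> \<open>The three terms come from \<open>P_bound\<close> applied to \<open>H u\<close>
    (its value and its Lipschitz constant) and from \<open>H_bound\<close> applied to
    \<open>P u\<close>, whose constant carries the factor \<open>lam\<close>.\<close>
  define K where "K = (norm \<gamma> * D x + (lam + norm \<gamma>) * D x + lam * D x) / (1 - lam)"
  have shift: "E u = E (P u)" if u: "u \<in> Lip" for u
  proof -
    \<comment> \<open>Applying \<open>P\<close> to the unfolding of \<open>H u\<close> and unfolding
      \<open>H (P u)\<close> once produce the same leading terms, which cancel in the
      commutator.\<close>
    have "P (H u) = (\<lambda>x. P (P u) x - sc \<gamma> (P u x) + P (H (P u)) x)"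
      by (subst H_unfold[OF u]) (simp add: P_add P_diff P_scale u P_Lip H_Lip Lip_scale Lip_diff)
    then show ?thesis
      unfolding E_def by (subst (2) H_unfold) (auto simp: u P_Lip)
  qed
  have E_iterate: "E u = E (iterate M sc f g u n)" for n
    by (induction n) (use shift[OF iterate_Lip[OF assms]] in \<open>auto simp: iterate_Suc_P simp del: iterate.simps(2)\<close>)
  have bound: "norm (E u) \<le> C * K" if u: "C-lipschitz_on UNIV u" for u C
  proof -
    have "norm (P (H u) x) \<le> norm \<gamma> * norm (H u x) + (lam + norm \<gamma>) * C / (1 - lam) * D x"
      by (rule P_bound[OF H_lipschitz[OF u]])
    also have "\<dots> \<le> norm \<gamma> * (C * D x / (1 - lam)) + (lam + norm \<gamma>) * C / (1 - lam) * D x"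
      by (intro add_right_mono mult_left_mono H_bound[OF u]) simp
    finally have "norm (E u) \<le> norm \<gamma> * (C * D x / (1 - lam)) + (lam + norm \<gamma>) * C / (1 - lam) * D x
        + lam * C * D x / (1 - lam)"
      unfolding E_def using H_bound[OF P_lipschitz[OF u], of x] norm_triangle_ineq4[of "P (H u) x" "H (P u) x"]
      by linarith
    also have "\<dots> = C * K"
      by (simp add: K_def add_divide_distrib algebra_simps)
    finally show ?thesis .
  qed
  \<comment> \<open>Replacing \<open>u\<close> by its n-th iterate leaves the commutator unchanged
    while its bound shrinks by \<open>lam ^ n\<close>.\<close>
  have "norm (E u) \<le> lam ^ n * (lip_const u * K)" for n
    using bound[OF iterate_lipschitz[OF lip_const_lipschitz[OF assms], of n]]
    by (simp add: E_iterate[of n] mult.assoc)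
  moreover have "(\<lambda>n. lam ^ n * (lip_const u * K)) \<longlonglongrightarrow> 0"
    using geometric_lam(1) by (rule summable_LIMSEQ_zero)
  ultimately have "norm (E u) \<le> 0"
    by (intro LIMSEQ_le_const[where X = "\<lambda>n. lam ^ n * (lip_const u * K)"]) auto
  then show "P (H u) x = H (P u) x" by (simp add: E_def)
qed

section \<open>Existence, uniqueness and linearity of the solution\<close>

lemma is_solution_iff:
  assumes "\<phi> \<in> Lip"
  shows "is_solution M sc f g F \<phi> \<longleftrightarrow> F = (\<lambda>x. \<phi> x - P \<phi> x)"
proof -
  \<comment> \<open>For Lipschitz \<phi> the integrability clause is automatic, so solving the
    equation means inverting the identity minus \<open>P\<close>.\<close>
  have "is_solution M sc f g F \<phi> \<longleftrightarrow> (\<forall>x. \<phi> x = P \<phi> x + F x)"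
    using P_integrable[OF assms] by (simp add: is_solution_def P_def)
  also have "\<dots> \<longleftrightarrow> F = (\<lambda>x. \<phi> x - P \<phi> x)"
    unfolding fun_eq_iff eq_diff_eq by (simp only: add.commute eq_commute)
  finally show ?thesis .
qed

lemma Lip_fixed_point_zero:
  assumes "\<gamma> \<noteq> 1" "u \<in> Lip" "P u = u"
  shows "u x = 0"
proof -
  \<comment> \<open>Minimality of \<open>lip_const u\<close> against the constant that
    \<open>P_lipschitz\<close> supplies for \<open>P u = u\<close>.\<close>
  have "lip_const u \<le> lam * lip_const u"
    using P_lipschitz[OF lip_const_lipschitz[OF assms(2)]] assms(2,3) by (simp add: lip_const_le)
  then have "(1 - lam) * lip_const u \<le> 0" by (simp add: algebra_simps)
  then have "lip_const u = 0"
    using lip_const_nonneg[OF assms(2)] lam by (simp add: mult_le_0_iff)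
  \<comment> \<open>With Lipschitz constant 0 the bound of \<open>P_diff_bound\<close> vanishes, so
    \<open>P\<close> acts on \<open>u\<close> as multiplication by \<gamma>.\<close>
  then have "P u x = sc \<gamma> (u x)"
    using P_diff_bound[OF lip_const_lipschitz[OF assms(2)], of x] by simp
  then have "sc (1 - \<gamma>) (u x) = 0"
    using assms(3) by (simp add: scale_left_diff_distrib)
  then show ?thesis using assms(1) by simp
qed

lemma solution_unique:
  assumes "\<gamma> \<noteq> 1" "\<phi> \<in> Lip" "\<psi> \<in> Lip" "(\<lambda>x. \<phi> x - P \<phi> x) = (\<lambda>x. \<psi> x - P \<psi> x)"
  shows "\<phi> = \<psi>"
proof -
  have "P (\<lambda>x. \<phi> x - \<psi> x) = (\<lambda>x. \<phi> x - \<psi> x)"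
  proof
    fix x
    have "\<phi> x = \<psi> x - P \<psi> x + P \<phi> x"
      using fun_cong[OF assms(4), of x] by (simp only: diff_eq_eq)
    then show "P (\<lambda>x. \<phi> x - \<psi> x) x = \<phi> x - \<psi> x"
      unfolding P_diff[OF assms(2,3)] by simp
  qed
  then have "\<phi> x - \<psi> x = 0" for x
    by (rule Lip_fixed_point_zero[OF assms(1) Lip_diff(1)[OF assms(2,3)]])
  then show ?thesis by (simp add: fun_eq_iff)
qed

lemma sol_H: "sol M sc f g F = (\<lambda>x. sc (1 / (1 - \<gamma>)) (H F x + F x))"
  by (simp add: sol_def H_def \<gamma>_def Let_def fun_eq_iff)

lemma sol_Lip: "F \<in> Lip \<Longrightarrow> sol M sc f g F \<in> Lip"
  unfolding sol_H by (intro Lip_scale Lip_add H_Lip)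

lemma sol_solves:
  assumes "\<gamma> \<noteq> 1" "F \<in> Lip"
  shows "(\<lambda>x. sol M sc f g F x - P (sol M sc f g F) x) = F"
proof
  fix x
  \<comment> \<open>Commutation turns \<open>P (H F)\<close> into \<open>H (P F)\<close>, the tail
    that \<open>H_unfold\<close> produces.\<close>
  have PS: "P (\<lambda>x. H F x + F x) = (\<lambda>x. H (P F) x + P F x)"
    using assms by (simp add: P_add H_Lip P_H)
  have "sol M sc f g F x - P (sol M sc f g F) x
      = sc (1 / (1 - \<gamma>)) (H F x + F x - (H (P F) x + P F x))"
    unfolding sol_H using assms
    by (simp add: P_scale[OF Lip_add] H_Lip PS flip: scale_right_diff_distrib)
  \<comment> \<open>After one unfolding the tails cancel and P F - \<gamma> F + F - P F
    remains.\<close>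
  also have "H F x + F x - (H (P F) x + P F x) = sc (1 - \<gamma>) (F x)"
    by (subst H_unfold[OF assms(2)]) (simp add: scale_left_diff_distrib)
  also have "sc (1 / (1 - \<gamma>)) (sc (1 - \<gamma>) (F x)) = F x"
    using assms(1) by simp
  finally show "sol M sc f g F x - P (sol M sc f g F) x = F x" .
qed

text \<open>By \<open>sol_solves\<close> both sides have the same image under the identity minus
  \<open>P\<close>. The two lemmas together say that \<open>sol\<close> inverts that operator on
  \<open>Lip\<close>.\<close>

lemma sol_unique:
  assumes "\<gamma> \<noteq> 1" "\<phi> \<in> Lip"
  shows "sol M sc f g (\<lambda>x. \<phi> x - P \<phi> x) = \<phi>"
  by (rule solution_unique) (intro sol_Lip sol_solves Lip_diff P_Lip assms)+

text \<open>No series are added: the identity minus \<open>P\<close> maps the pointwise sum to F +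
  G, and \<open>sol_unique\<close> identifies it.\<close>

lemma sol_add:
  assumes "\<gamma> \<noteq> 1" "F \<in> Lip" "G \<in> Lip"
  shows "sol M sc f g (\<lambda>x. F x + G x) = (\<lambda>x. sol M sc f g F x + sol M sc f g G x)" (is "_ = ?s")
proof -
  have "?s x - P ?s x = F x + G x" for x
    using sol_solves[OF assms(1,2), THEN fun_cong, of x] sol_solves[OF assms(1,3), THEN fun_cong, of x]
    by (simp add: P_add sol_Lip assms add_diff_add)
  then show ?thesis
    using sol_unique[OF assms(1), of ?s] assms by (simp add: Lip_add sol_Lip)
qed

lemma sol_scale:
  assumes "\<gamma> \<noteq> 1" "F \<in> Lip"
  shows "sol M sc f g (\<lambda>x. sc a (F x)) = (\<lambda>x. sc a (sol M sc f g F x))" (is "_ = ?s")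
proof -
  have "?s x - P ?s x = sc a (F x)" for x
    using sol_solves[OF assms, THEN fun_cong, of x]
    by (simp add: P_scale sol_Lip assms flip: scale_right_diff_distrib)
  then show ?thesis
    using sol_unique[OF assms(1), of ?s] assms by (simp add: Lip_scale sol_Lip)
qed

section \<open>Norm estimates and the homeomorphism of \<open>Lip\<close>\<close>

lemma sol_norm_bound:
  assumes "F \<in> Lip"
  shows "norm (sol M sc f g F x) \<le> (lip_const F * D x / (1 - lam) + norm (F x)) / norm (1 - \<gamma>)"
proof -
  have "norm (H F x + F x) \<le> lip_const F * D x / (1 - lam) + norm (F x)"
    using H_bound[OF lip_const_lipschitz[OF assms], of x] norm_triangle_ineq[of "H F x" "F x"] by linarith
  then show ?thesis
    unfolding sol_H by (simp add: norm_scale norm_divide divide_right_mono)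
qed

lemma sol_lip_const:
  assumes "F \<in> Lip"
  shows "lip_const (sol M sc f g F) \<le> lip_const F * (1 + norm \<gamma>) / (1 - lam) / norm (1 - \<gamma>)"
proof (rule lip_const_le[OF sol_Lip[OF assms]])
  have "(norm (1 / (1 - \<gamma>)) * ((lam + norm \<gamma>) * lip_const F / (1 - lam) + lip_const F))-lipschitz_on
      UNIV (sol M sc f g F)"
    unfolding sol_H
    by (intro lipschitz_on_scale lipschitz_on_add H_lipschitz lip_const_lipschitz assms)
  \<comment> \<open>The contribution of \<open>F\<close> itself cancels \<open>lam\<close> in the
    numerator; this gives the part (1 + |\<gamma>|) / (1 - lam) of the final constant.\<close>
  moreover have "(lam + norm \<gamma>) * lip_const F / (1 - lam) + lip_const F = lip_const F * (1 + norm \<gamma>) / (1 - lam)"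
    using lam by (simp add: field_simps)
  ultimately show "(lip_const F * (1 + norm \<gamma>) / (1 - lam) / norm (1 - \<gamma>))-lipschitz_on UNIV (sol M sc f g F)"
    by (simp add: norm_divide mult.commute)
qed

text \<open>In the two applications \<open>m\<close> is \<open>\<parallel>F(x\<^sub>0)\<parallel>\<close> or the supremum norm of \<open>F\<close>.\<close>

lemma combine_bounds:
  assumes "0 \<le> m" "0 \<le> l"
    and s: "s \<le> (l * \<delta> / (1 - lam) + m) / norm (1 - \<gamma>)"
    and l': "l' \<le> l * (1 + norm \<gamma>) / (1 - lam) / norm (1 - \<gamma>)"
  shows "s + l' \<le> max 1 ((\<delta> + 1 + norm \<gamma>) / (1 - lam)) / norm (1 - \<gamma>) * (m + l)" (is "_ \<le> ?c / _ * _")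
proof -
  have "s + l' \<le> (l * \<delta> / (1 - lam) + m) / norm (1 - \<gamma>) + l * (1 + norm \<gamma>) / (1 - lam) / norm (1 - \<gamma>)"
    by (intro add_mono s l')
  also have "\<dots> = (m + (\<delta> + 1 + norm \<gamma>) / (1 - lam) * l) / norm (1 - \<gamma>)"
    by (simp add: add_divide_distrib algebra_simps)
  \<comment> \<open>The coefficient of \<open>m\<close> is 1 and that of \<open>l\<close> is the
    quotient; the maximum dominates both.\<close>
  also have "\<dots> \<le> (?c * m + ?c * l) / norm (1 - \<gamma>)"
    using mult_right_mono[of 1 ?c m] mult_right_mono[of "(\<delta> + 1 + norm \<gamma>) / (1 - lam)" ?c l] assms(1,2)
    by (intro divide_right_mono add_mono) auto
  finally show ?thesis by (simp add: distrib_left add_divide_distrib)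
qed

lemma lip_norm_sol:
  assumes "F \<in> Lip"
  shows "lip_norm x0 (sol M sc f g F)
    \<le> max 1 ((D x0 + 1 + norm \<gamma>) / (1 - lam)) / norm (1 - \<gamma>) * lip_norm x0 F"
  unfolding lip_norm_def
  by (intro combine_bounds sol_norm_bound sol_lip_const lip_const_nonneg assms) simp

lemma lip_const_defect: "u \<in> Lip \<Longrightarrow> lip_const (\<lambda>x. u x - P u x) \<le> lip_const u + lam * lip_const u"
  using Lip_diff(2)[OF _ P_Lip, of u u] lip_const_le[OF P_Lip P_lipschitz[OF lip_const_lipschitz], of u] by simp

lemma norm_defect:
  assumes "u \<in> Lip"
  shows "norm (u x - P u x) \<le> (1 + norm \<gamma>) * norm (u x) + lip_const u * D x"
  using P_bound[OF lip_const_lipschitz[OF assms], of x] norm_triangle_ineq4[of "u x" "P u x"]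
  by (simp add: distrib_right)

text \<open>Serves the continuity of the inverse operator, with \<delta> either \<open>D x0\<close>
  or a uniform bound of \<open>D\<close>. The constant is crude: \<open>lam\<close> is replaced by 1
  and nonnegative terms are added to obtain a product.\<close>

lemma combine_defect_bounds:
  assumes "0 \<le> m" "0 \<le> l" "0 \<le> \<delta>" "s \<le> (1 + norm \<gamma>) * m + l * \<delta>" "l' \<le> l + lam * l"
  shows "s + l' \<le> (2 + norm \<gamma> + \<delta>) * (m + l)"
proof -
  have "lam * l \<le> 1 * l"
    using assms lam by (intro mult_right_mono) auto
  moreover have "0 \<le> norm \<gamma> * l" "0 \<le> \<delta> * m"
    using assms by auto
  moreover have "(2 + norm \<gamma> + \<delta>) * (m + l) = (1 + norm \<gamma>) * m + m + norm \<gamma> * l + 2 * l + \<delta> * m + l * \<delta>"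
    by (simp add: algebra_simps)
  ultimately show ?thesis
    using assms by linarith
qed

lemma lip_norm_defect:
  assumes "u \<in> Lip"
  shows "lip_norm x0 (\<lambda>x. u x - P u x) \<le> (2 + norm \<gamma> + D x0) * lip_norm x0 u"
  unfolding lip_norm_def
  by (intro combine_defect_bounds norm_defect lip_const_defect lip_const_nonneg assms D_nonneg) simp

lemma linear_homeomorphism_Lip:
  assumes "\<gamma> \<noteq> 1"
  shows "linear_homeomorphism sc Lip (lip_norm x0) (sol M sc f g)"
proof (rule linear_homeomorphismI[where R = "\<lambda>u x. u x - P u x"])
  show "(\<lambda>x. u x - v x - P (\<lambda>x. u x - v x) x) = (\<lambda>x. u x - P u x - (v x - P v x))"
    if "u \<in> Lip" "v \<in> Lip" for u v
    using that by (simp add: P_diff fun_eq_iff)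
qed (use assms in \<open>auto intro!: Metric_space_Lip sol_add sol_scale sol_Lip lip_norm_sol Lip_diff P_Lip
    lip_norm_defect sol_solves sol_unique\<close>)

section \<open>Bounded Lipschitz functions under a uniform displacement bound\<close>

context
  fixes \<delta> :: real
  assumes D_le: "\<And>x. D x \<le> \<delta>"
begin

lemma SUP_norm_nonneg: "u \<in> BL \<Longrightarrow> 0 \<le> (SUP x::'x. norm (u x :: 'y))"
  using norm_le_SUP[of u] norm_ge_zero order_trans unfolding BL_def by blast

text \<open>The right side does not depend on \<open>x\<close>, so it yields both the boundedness of
  the solution and the supremum part of its norm.\<close>

lemma sol_norm_bound_SUP:
  assumes "F \<in> BL"
  shows "norm (sol M sc f g F x) \<le> (lip_const F * \<delta> / (1 - lam) + (SUP x. norm (F x))) / norm (1 - \<gamma>)"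
proof -
  have F: "F \<in> Lip" "bounded (range F)" using assms by (auto simp: BL_def)
  have "lip_const F * D x / (1 - lam) + norm (F x) \<le> lip_const F * \<delta> / (1 - lam) + (SUP x. norm (F x))"
    using lam D_le lip_const_nonneg[OF F(1)] norm_le_SUP[OF F(2)]
    by (intro add_mono divide_right_mono mult_left_mono) auto
  then show ?thesis
    using sol_norm_bound[OF F(1), of x] by (meson divide_right_mono norm_ge_zero order_trans)
qed

lemma norm_defect_SUP:
  assumes "u \<in> BL"
  shows "norm (u x - P u x) \<le> (1 + norm \<gamma>) * (SUP x. norm (u x)) + lip_const u * \<delta>"
proof -
  have u: "u \<in> Lip" "bounded (range u)" using assms by (auto simp: BL_def)
  have "(1 + norm \<gamma>) * norm (u x) + lip_const u * D x \<le> (1 + norm \<gamma>) * (SUP x. norm (u x)) + lip_const u * \<delta>"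
    using D_le lip_const_nonneg[OF u(1)] norm_le_SUP[OF u(2)]
    by (intro add_mono mult_left_mono) auto
  then show ?thesis using norm_defect[OF u(1), of x] by linarith
qed

lemma sol_BL: "F \<in> BL \<Longrightarrow> sol M sc f g F \<in> BL"
  using sol_norm_bound_SUP[of F] sol_Lip[of F] unfolding BL_def bounded_iff by blast

lemma defect_BL: "u \<in> BL \<Longrightarrow> (\<lambda>x. u x - P u x) \<in> BL"
  using norm_defect_SUP[of u] Lip_diff(1)[of u "P u"] P_Lip[of u] unfolding BL_def bounded_iff by blast

lemma bl_norm_sol:
  assumes "F \<in> BL"
  shows "bl_norm (sol M sc f g F) \<le> max 1 ((\<delta> + 1 + norm \<gamma>) / (1 - lam)) / norm (1 - \<gamma>) * bl_norm F"
proof -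
  have "F \<in> Lip" using assms by (simp add: BL_def)
  then show ?thesis
    unfolding bl_norm_def
    by (intro combine_bounds sol_lip_const lip_const_nonneg SUP_norm_nonneg assms cSUP_least
        sol_norm_bound_SUP) auto
qed

lemma bl_norm_defect:
  assumes "u \<in> BL"
  shows "bl_norm (\<lambda>x. u x - P u x) \<le> (2 + norm \<gamma> + \<delta>) * bl_norm u"
proof -
  have "u \<in> Lip" using assms by (simp add: BL_def)
  \<comment> \<open>The type of points is inhabited, so some nonnegative \<open>D x\<close> lies
    below \<delta>.\<close>
  moreover have "0 \<le> \<delta>" using D_le D_nonneg order_trans by blast
  ultimately show ?thesis
    unfolding bl_norm_def
    by (intro combine_defect_bounds lip_const_defect lip_const_nonneg SUP_norm_nonneg assms cSUP_least
        norm_defect_SUP) auto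
qed

text \<open>The algebraic identities are inherited from \<open>Lip\<close>; what is specific to
  \<open>BL\<close> is its invariance under both operators and the bounds in
  \<open>bl_norm\<close>.\<close>

lemma linear_homeomorphism_BL:
  assumes "\<gamma> \<noteq> 1"
  shows "linear_homeomorphism sc BL bl_norm (sol M sc f g)"
proof (rule linear_homeomorphismI[where R = "\<lambda>u x. u x - P u x"])
  have Lip: "u \<in> Lip" if "u \<in> BL" for u :: "'x \<Rightarrow> 'y"
    using that by (simp add: BL_def)
  show "(\<lambda>x. u x - v x - P (\<lambda>x. u x - v x) x) = (\<lambda>x. u x - P u x - (v x - P v x))"
    if "u \<in> BL" "v \<in> BL" for u v
    using that by (simp add: P_diff Lip fun_eq_iff)
  show "sol M sc f g (\<lambda>x. u x + v x) = (\<lambda>x. sol M sc f g u x + sol M sc f g v x)"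
    if "u \<in> BL" "v \<in> BL" for u v
    using that assms by (intro sol_add Lip)
  show "sol M sc f g (\<lambda>x. sc a (u x)) = (\<lambda>x. sc a (sol M sc f g u x))" if "u \<in> BL" for a u
    using that assms by (intro sol_scale Lip)
  show "(\<lambda>x. sol M sc f g u x - P (sol M sc f g u) x) = u" if "u \<in> BL" for u
    using that assms by (intro sol_solves Lip)
  show "sol M sc f g (\<lambda>x. u x - P u x) = u" if "u \<in> BL" for u
    using that assms by (intro sol_unique Lip)
qed (auto intro!: Metric_space_BL sol_BL bl_norm_sol BL_diff bl_norm_defect defect_BL)

end

end

theorem theorem4p1:
  fixes M :: "'w measure"
    and x0 :: "'x::metric_space"
    and lam c0 c d0 d :: real
    and f :: "'x \<Rightarrow> 'w \<Rightarrow> 'x"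
    and g :: "'w \<Rightarrow> 'k::real_or_complex"
    and \<gamma> :: 'k
    and sc :: "'k \<Rightarrow> 'y::{banach, second_countable_topology} \<Rightarrow> 'y"
  assumes X_separable: "separable_space (euclidean :: 'x topology)"
    and Y: "separable_banach_over sc"
    and lam: "0 \<le> lam" "lam < 1"
    and H1: "\<And>x B. B \<in> sets borel \<Longrightarrow> {\<omega> \<in> space M. f x \<omega> \<in> B} \<in> sets M"
    and H2: "integrable M g"
      "\<And>x. (\<integral>\<^sup>+\<omega>. ennreal (norm (g \<omega>) * dist (f x \<omega>) x) \<partial>M) < \<infinity>"
      "\<And>x z. (\<integral>\<^sup>+\<omega>. ennreal (norm (g \<omega>) * dist (f x \<omega>) (f z \<omega>)) \<partial>M) \<le> ennreal (lam * dist x z)"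
    and gamma: "\<gamma> = (\<integral>\<omega>. g \<omega> \<partial>M)" "\<gamma> \<noteq> 1"
    and c0: "c0 = 1 / (1 - lam) * ((\<integral>\<omega>. norm (g \<omega>) * dist (f x0 \<omega>) x0 \<partial>M) + 1 + norm \<gamma>)"
    and c: "c = max 1 c0"
    and d0: "d0 = (SUP x. \<integral>\<omega>. norm (g \<omega>) * dist (f x \<omega>) x \<partial>M)"
    and d: "d = max 1 ((d0 + 1 + norm \<gamma>) / (1 - lam))"
  shows
    "(\<forall>F\<in>Lip.
        (\<forall>n. iterate M sc f g F n \<in> Lip \<and>
             (\<forall>x. integrable M (\<lambda>\<omega>. sc (g \<omega>) (iterate M sc f g F n (f x \<omega>))))) \<and>
        (\<forall>x. summable (\<lambda>n. iterate M sc f g F (Suc n) x - sc \<gamma> (iterate M sc f g F n x))) \<and>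
        sol M sc f g F \<in> Lip \<and>
        is_solution M sc f g F (sol M sc f g F) \<and>
        (\<forall>\<phi>\<in>Lip. is_solution M sc f g F \<phi> \<longrightarrow> \<phi> = sol M sc f g F)) \<and>
     linear_homeomorphism sc Lip (lip_norm x0) (sol M sc f g) \<and>
     (\<forall>F\<in>Lip. lip_norm x0 (sol M sc f g F) \<le> c / norm (1 - \<gamma>) * lip_norm x0 F) \<and>
     (bdd_above (range (\<lambda>x. \<integral>\<omega>. norm (g \<omega>) * dist (f x \<omega>) x \<partial>M)) \<longrightarrow>
        linear_homeomorphism sc BL bl_norm (sol M sc f g) \<and>
        (\<forall>F\<in>BL. bl_norm (sol M sc f g F) \<le> d / norm (1 - \<gamma>) * bl_norm F))"
proof -
  interpret separable_banach_over sc by (rule Y)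
  interpret K: contractive_kernel sc M f g lam
    using lam H1 H2 by unfold_locales auto
  have \<gamma>: "K.\<gamma> = \<gamma>" "K.\<gamma> \<noteq> 1"
    using gamma by (simp_all add: K.\<gamma>_def)
  have c': "c = max 1 ((K.D x0 + 1 + norm \<gamma>) / (1 - lam))"
    by (simp add: c c0 K.D_def)
  show ?thesis
  proof (intro conjI ballI allI impI)
    fix F :: "'x \<Rightarrow> 'y" assume F: "F \<in> Lip"
    show "iterate M sc f g F n \<in> Lip" for n
      by (rule K.iterate_Lip[OF F])
    show "integrable M (\<lambda>\<omega>. sc (g \<omega>) (iterate M sc f g F n (f x \<omega>)))" for n x
      by (rule K.P_integrable[OF K.iterate_Lip[OF F]])
    show "summable (\<lambda>n. iterate M sc f g F (Suc n) x - sc \<gamma> (iterate M sc f g F n x))" for x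
      using K.H_summable[OF F] by (simp only: \<gamma>(1))
    show "sol M sc f g F \<in> Lip"
      by (rule K.sol_Lip[OF F])
    show "is_solution M sc f g F (sol M sc f g F)"
      using K.sol_solves[OF \<gamma>(2) F] by (simp add: K.is_solution_iff K.sol_Lip F)
    show "\<phi> = sol M sc f g F" if "\<phi> \<in> Lip" "is_solution M sc f g F \<phi>" for \<phi>
      using K.sol_unique[OF \<gamma>(2) that(1)] that by (simp add: K.is_solution_iff)
    show "lip_norm x0 (sol M sc f g F) \<le> c / norm (1 - \<gamma>) * lip_norm x0 F"
      using K.lip_norm_sol[OF F, of x0] by (simp only: c' \<gamma>(1))
  next
    show "linear_homeomorphism sc Lip (lip_norm x0) (sol M sc f g)"
      by (rule K.linear_homeomorphism_Lip[OF \<gamma>(2)])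
  next
    assume bdd: "bdd_above (range (\<lambda>x. \<integral>\<omega>. norm (g \<omega>) * dist (f x \<omega>) x \<partial>M))"
    \<comment> \<open>Boundedness of the range makes \<open>d0\<close> a genuine upper bound; the
      real supremum of an unbounded set would carry no information.\<close>
    have D_le: "K.D x \<le> d0" for x
      unfolding K.D_def d0 by (rule cSUP_upper[OF UNIV_I bdd])
    show "linear_homeomorphism sc BL bl_norm (sol M sc f g)"
      by (rule K.linear_homeomorphism_BL[OF D_le \<gamma>(2)])
    show "bl_norm (sol M sc f g F) \<le> d / norm (1 - \<gamma>) * bl_norm F" if "F \<in> BL" for F
      using K.bl_norm_sol[OF D_le that] by (simp only: d \<gamma>(1))
  qed
qed

end
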